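(* Let $\aleph$ be an alphabet with an arity map $\aleph\to\mathbb Z_{\ge0}$, $\alpha\mapsto|\alpha|$, and let $\mathfrak X=\{\alpha\in\aleph:|\alpha|=0\}$ and $\Omega=\{\alpha\in\aleph:|\alpha|>0\}$. Then the set of $\Omega$-words coincides with $\Gamma_1(\aleph)$.
   Context: $\Gamma(\aleph)$ is the set of finite sequences $a=\alpha_1\alpha_2\cdots\alpha_k$ of elements of $\aleph$. The weight of $\alpha\in\aleph$ is $\|\alpha\|=1-|\alpha|\in\mathbb Z$, and $\|\alpha_1\cdots\alpha_k\|=\|\alpha_1\|+\cdots+\|\alpha_k\|$. For $a=\alpha_1\cdots\alpha_k$ put $\mu_i(a)=\|\alpha_i\|+\cdots+\|\alpha_k\|$, $i=1,\ldots,k$. $\Gamma_1(\aleph)$ is the set of $a=\alpha_1\cdots\alpha_k\in\Gamma(\aleph)$ such that $\|a\|=1$ and $\mu_i(a)\ge1$ for all $i=1,\ldots,k$. $\Omega$-words are the elements of $\Gamma(\aleph)$ defined inductively: every element of $\mathfrak X$ is an $\Omega$-word (of length one); if $\omega\in\Omega$, $|\omega|=k$, and $a_1,\ldots,a_k$ are $\Omega$-words, then the concatenation $\omega a_1\cdots a_k$ is an $\Omega$-word; every $\Omega$-word is obtained by these two rules. *)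

theory Defs
  imports Main
begin

text \<open>
  An alphabet is a set \<open>A\<close> of letters (possibly infinite or empty) with an arity map \<open>ar\<close>;
  only the values of \<open>ar\<close> on \<open>A\<close> matter.
  Finite sequences are lists, and the empty sequence is allowed.
\<close>

definition Gamma :: "'a set \<Rightarrow> 'a list set" where
  "Gamma A = lists A"

definition nullary_letters :: "'a set \<Rightarrow> ('a \<Rightarrow> nat) \<Rightarrow> 'a set" where
  "nullary_letters A ar = {\<alpha> \<in> A. ar \<alpha> = 0}"

definition operation_letters :: "'a set \<Rightarrow> ('a \<Rightarrow> nat) \<Rightarrow> 'a set" where
  "operation_letters A ar = {\<alpha> \<in> A. ar \<alpha> > 0}"

definition letter_weight :: "('a \<Rightarrow> nat) \<Rightarrow> 'a \<Rightarrow> int" where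
  "letter_weight ar \<alpha> = 1 - int (ar \<alpha>)"

definition weight :: "('a \<Rightarrow> nat) \<Rightarrow> 'a list \<Rightarrow> int" where
  "weight ar a = (\<Sum>\<alpha>\<leftarrow>a. letter_weight ar \<alpha>)"

text \<open>
  The index \<open>i\<close> of \<open>suffix_weight\<close> runs over \<open>1, \<dots>, length a\<close>, whereas list access
  counts from \<open>0\<close>, so the \<open>j\<close>-th letter of \<open>a\<close> is \<open>a ! (j - 1)\<close>.
\<close>

definition suffix_weight :: "('a \<Rightarrow> nat) \<Rightarrow> nat \<Rightarrow> 'a list \<Rightarrow> int" where
  "suffix_weight ar i a = (\<Sum>j = i..length a. letter_weight ar (a ! (j - 1)))"

definition Gamma1 :: "'a set \<Rightarrow> ('a \<Rightarrow> nat) \<Rightarrow> 'a list set" where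
  "Gamma1 A ar =
    {a \<in> Gamma A. weight ar a = 1 \<and> (\<forall>i \<in> {1..length a}. suffix_weight ar i a \<ge> 1)}"

inductive_set Omega_words :: "'a set \<Rightarrow> ('a \<Rightarrow> nat) \<Rightarrow> 'a list set"
  for A :: "'a set" and ar :: "'a \<Rightarrow> nat"
where
  letter: "x \<in> nullary_letters A ar \<Longrightarrow> [x] \<in> Omega_words A ar"
| operation: "\<omega> \<in> operation_letters A ar \<Longrightarrow> length ws = ar \<omega> \<Longrightarrow>
    (\<forall>w \<in> set ws. w \<in> Omega_words A ar) \<Longrightarrow> \<omega> # concat ws \<in> Omega_words A ar"

end

theory Submission
  imports Defs
begin

text \<open>
  Read from right to left, a sequence all of whose nonempty suffixes have positive weight is
  a concatenation of \<open>\<Omega>\<close>-words, as many as its weight: prepending a letter \<open>\<alpha>\<close> fuses the first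
  \<open>\<bar>\<alpha>\<bar>\<close> of them into a single word,
  and positivity guarantees that so many are available. For weight \<open>1\<close> there is exactly one word.
\<close>

text \<open>Index-free form of the condition on \<open>suffix_weight\<close> in
  \<open>Gamma1\<close>, so that proofs can go by induction on the list.\<close>

primrec positive_suffixes :: "('a \<Rightarrow> nat) \<Rightarrow> 'a list \<Rightarrow> bool" where
  "positive_suffixes ar [] \<longleftrightarrow> True"
| "positive_suffixes ar (x # a) \<longleftrightarrow> weight ar (x # a) \<ge> 1 \<and> positive_suffixes ar a"

lemma weight_Nil [simp]: "weight ar [] = 0"
  by (simp add: weight_def)

lemma weight_Cons [simp]: "weight ar (x # a) = 1 - int (ar x) + weight ar a"
  by (simp add: weight_def letter_weight_def)

lemma weight_append [simp]: "weight ar (a @ b) = weight ar a + weight ar b"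
  by (simp add: weight_def)

text \<open>A nonempty suffix of \<open>a @ b\<close> lies in \<open>b\<close> or is a nonempty
  suffix of \<open>a\<close> followed by \<open>b\<close>; in the second case \<open>b\<close>
  cannot lower its weight.\<close>

lemma positive_suffixes_append:
  "\<lbrakk>positive_suffixes ar a; positive_suffixes ar b; weight ar b \<ge> 0\<rbrakk>
    \<Longrightarrow> positive_suffixes ar (a @ b)"
  by (induction a) auto

lemma suffix_weight_1: "suffix_weight ar 1 a = weight ar a"
  by (simp add: suffix_weight_def weight_def sum_list_sum_nth atLeast0LessThan
      sum.atLeast1_atMost_eq)

lemma suffix_weight_Cons_Suc:
  assumes "i \<ge> 1"
  shows "suffix_weight ar (Suc i) (x # a) = suffix_weight ar i a"
proof -
  have "suffix_weight ar (Suc i) (x # a)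
      = (\<Sum>j = Suc i..Suc (length a). letter_weight ar ((x # a) ! (j - 1)))"
    by (simp add: suffix_weight_def)
  also have "\<dots> = (\<Sum>j = i..length a. letter_weight ar ((x # a) ! j))"
    by (subst sum.shift_bounds_cl_Suc_ivl) simp
  \<comment> \<open>Here \<open>j \<ge> i \<ge> 1\<close>, so \<open>(x # a) ! j\<close> is
    \<open>a ! (j - 1)\<close>; at \<open>j = 0\<close> truncated subtraction would compare
    \<open>x\<close> with \<open>a ! 0\<close>.\<close>
  also have "\<dots> = suffix_weight ar i a"
    unfolding suffix_weight_def using assms by (intro sum.cong) (auto simp: nth_Cons')
  finally show ?thesis .
qed

lemma positive_suffixes_iff:
  "positive_suffixes ar a \<longleftrightarrow> (\<forall>i \<in> {1..length a}. suffix_weight ar i a \<ge> 1)"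
proof (induction a)
  case Nil
  show ?case by simp
next
  case (Cons x a)
  have split: "{1..length (x # a)} = insert 1 (Suc ` {1..length a})"
    by (auto simp: image_Suc_atLeastAtMost)
  have "(\<forall>i \<in> {1..length (x # a)}. suffix_weight ar i (x # a) \<ge> 1) \<longleftrightarrow>
      suffix_weight ar 1 (x # a) \<ge> 1 \<and>
      (\<forall>i \<in> {1..length a}. suffix_weight ar (Suc i) (x # a) \<ge> 1)"
    unfolding split by (simp del: image_Suc_atLeastAtMost)
  then show ?case
    using Cons.IH by (simp add: suffix_weight_1 [unfolded One_nat_def] suffix_weight_Cons_Suc)
qed

lemma Gamma1_iff:
  "a \<in> Gamma1 A ar \<longleftrightarrow> a \<in> lists A \<and> weight ar a = 1 \<and> positive_suffixes ar a"
  by (simp add: Gamma1_def Gamma_def positive_suffixes_iff)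

text \<open>Each word contributes weight \<open>1\<close>. Hence prepending a letter of arity
  \<open>length ws\<close> brings the total back to \<open>1\<close>, as the operation rule
  requires.\<close>

lemma concat_Gamma1:
  assumes "\<forall>w \<in> set ws. w \<in> Gamma1 A ar"
  shows "concat ws \<in> lists A \<and> weight ar (concat ws) = int (length ws) \<and>
    positive_suffixes ar (concat ws)"
  using assms by (induction ws) (auto simp: Gamma1_iff intro!: positive_suffixes_append)

lemma Omega_words_in_Gamma1: "a \<in> Omega_words A ar \<Longrightarrow> a \<in> Gamma1 A ar"
proof (induction rule: Omega_words.induct)
  case (letter x)
  then show ?case by (simp add: Gamma1_iff nullary_letters_def)
next
  case (operation \<omega> ws)
  then show ?case
    using concat_Gamma1 [of ws A ar] by (simp add: Gamma1_iff operation_letters_def)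
qed

text \<open>The weight is left arbitrary for the induction: tails of a sequence of weight
  \<open>1\<close> can have any positive weight, or weight \<open>0\<close> when empty.\<close>

lemma positive_suffixes_decompose:
  assumes "a \<in> lists A" and "positive_suffixes ar a"
  shows "\<exists>ws. a = concat ws \<and> set ws \<subseteq> Omega_words A ar \<and> int (length ws) = weight ar a"
  using assms
proof (induction a rule: lists.induct)
  case Nil
  show ?case by (intro exI [of _ "[]"]) simp
next
  case (Cons x a)
  then obtain ws where ws: "a = concat ws" "set ws \<subseteq> Omega_words A ar"
      "int (length ws) = weight ar a"
    by auto
  define w where "w = x # concat (take (ar x) ws)"
  \<comment> \<open>The weight \<open>1 - ar x + length ws\<close> of \<open>x # a\<close> is at
    least \<open>1\<close>.\<close>
  have le: "ar x \<le> length ws"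
    using Cons.prems ws by simp
  have "w \<in> Omega_words A ar"
  proof (cases "ar x = 0")
    case True
    then show ?thesis
      using Cons.hyps(1) by (simp add: w_def nullary_letters_def Omega_words.letter)
  next
    case False
    then show ?thesis
      unfolding w_def using Cons.hyps(1) le ws(2)
      by (intro Omega_words.operation) (auto simp: operation_letters_def dest: in_set_takeD)
  qed
  moreover have "x # a = concat (w # drop (ar x) ws)"
    using ws(1) by (simp add: w_def flip: concat_append)
  \<comment> \<open>Fusing removes \<open>ar x\<close> words and adds one, which changes the count
    by exactly the weight of \<open>x\<close>.\<close>
  moreover have "int (length (w # drop (ar x) ws)) = weight ar (x # a)"
    using le ws(3) by simp
  ultimately show ?case
    using ws(2) set_drop_subset [of "ar x" ws] by (intro exI [of _ "w # drop (ar x) ws"]) auto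
qed

lemma Gamma1_in_Omega_words:
  assumes "a \<in> Gamma1 A ar"
  shows "a \<in> Omega_words A ar"
proof -
  obtain ws where ws: "a = concat ws" "set ws \<subseteq> Omega_words A ar" "int (length ws) = 1"
    using assms positive_suffixes_decompose [of a A ar] by (auto simp: Gamma1_iff)
  then obtain w where "ws = [w]"
    by (auto simp: length_Suc_conv)
  with ws show ?thesis by simp
qed

theorem theorem2p3:
  fixes A :: "'a set" and ar :: "'a \<Rightarrow> nat"
  shows "Omega_words A ar = Gamma1 A ar"
  using Omega_words_in_Gamma1 Gamma1_in_Omega_words by blast

end
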